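(* Let $d>0$. Let $\tau=\{t_n,\ n\in\mathbb{Z}\}$ be any renewal process sampling scheme satisfying Assumptions A1, A3 and A4 (stated in the context, A4 with this $d$), and suppose further that the inter-sample spacing distribution has a density that is positive over a semi-infinite interval (i.e. over $[a,\infty)$ for some finite $a$). Then, for every finite $\lambda_0>0$, $\tau$ is alias-free, in the sense of Definition 2 (stated in the context), relative to the class of spectra limited to the band $[-\lambda_0,\lambda_0]$.
   Context: Processes: $X=\{X(t),\ -\infty<t<\infty\}$ denotes a real, mean square continuous, wide sense stationary stochastic process with mean zero, covariance function $C(t)=E[X(s+t)X(s)]$ and spectral distribution (spectrum) $\Phi$, i.e. the finite measure on $\mathbb{R}$ with $C(t)=\int_{-\infty}^{\infty}e^{i\lambda t}\,d\Phi(\lambda)$ (up to an immaterial normalizing constant). A spectrum is limited to the band $[-\lambda_0,\lambda_0]$ if $\Phi$ is supported on $[-\lambda_0,\lambda_0]$. Sampling process: $\tau=\{t_n,\ n=\ldots,-2,-1,0,1,2,\ldots\}$ is a sequence of real-valued, stochastic sampling times. It is a renewal process sampling scheme if the inter-sample spacings $t_{n+1}-t_n$, for different values of $n$, are independent and identically distributed. Assumption A1: the process $\tau$ is independent of $X$ (for every process $X$ considered). Assumption A3: the process $\tau$ constitutes a stationary orderly second-order point process on the real line. (Orderly: the probability of two or more points in an interval of length $h$ is $o(h)$ as $h\downarrow0$. Second-order: the number $N(B)$ of points in any bounded Borel set $B$ has finite second moment.) Assumption A4: the time separation between two successive sample points is at least $d$, i.e. $t_{n+1}-t_n\ge d$ for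 every index $n$, for the fixed $d>0$. Let $\mathbb{B}$ be the Borel $\sigma$-field on $\mathbb{R}$. Let $\beta$ be the mean intensity of $\tau$ ($E[N(B)]=\beta|B|$, with $|B|$ the Lebesgue measure of $B$) and let $\mu_c$ be its reduced covariance measure, i.e. $\mathrm{Cov}(N(A),N(B))=\int_A\mu_c(B-x)\,dx$ for bounded Borel sets $A,B$. The compound process is $Z=\{Z(B),\ B\in\mathbb{B}\}$ with $Z(B)=\sum_{t_i\in B}X(t_i)$. It is second order stationary, and its (reduced) covariance measure $\mu_z$ is given by $$\mu_z(B)=\int_B C(u)\,[\beta^2\,du+\mu_c(du)].$$ Definition 2: a sampling process $\tau$ satisfying A1 and A3 is alias-free relative to a class of spectra $\mathbb{S}$ if no two random processes with different spectra belonging to $\mathbb{S}$ yield the same covariance measure $\mu_z$ of the compound process. *)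

theory Defs
  imports "HOL-Probability.Probability"
begin

definition bounded_borel :: "real set set"
  where "bounded_borel = {B \<in> sets borel. bounded B}"


section \<open>The observed process and its spectrum\<close>

definition wss_process :: "'p measure \<Rightarrow> (real \<Rightarrow> 'p \<Rightarrow> real) \<Rightarrow> bool"
  where "wss_process P X \<longleftrightarrow>
    (\<forall>u. X u \<in> borel_measurable P) \<and>
    (\<forall>u. integrable P (\<lambda>\<omega>. (X u \<omega>)\<^sup>2)) \<and>
    (\<forall>u. (LINT \<omega>|P. X u \<omega>) = 0) \<and>
    (\<forall>s u v. (LINT \<omega>|P. X (s + u) \<omega> * X s \<omega>) = (LINT \<omega>|P. X (v + u) \<omega> * X v \<omega>)) \<and>
    (\<forall>u. ((\<lambda>v. LINT \<omega>|P. (X v \<omega> - X u \<omega>)\<^sup>2) \<longlongrightarrow> 0) (at u))"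

definition covariance_function :: "'p measure \<Rightarrow> (real \<Rightarrow> 'p \<Rightarrow> real) \<Rightarrow> real \<Rightarrow> real"
  where "covariance_function P X u = (LINT \<omega>|P. X u \<omega> * X 0 \<omega>)"

definition is_spectrum :: "'p measure \<Rightarrow> (real \<Rightarrow> 'p \<Rightarrow> real) \<Rightarrow> real measure \<Rightarrow> bool"
  where "is_spectrum P X \<Phi> \<longleftrightarrow>
    finite_borel_measure \<Phi> \<and>
    (\<forall>u. complex_of_real (covariance_function P X u) = char \<Phi> u)"

definition band_limited_spectra :: "real \<Rightarrow> real measure set"
  where "band_limited_spectra w =
    {\<Phi>. finite_borel_measure \<Phi> \<and> emeasure \<Phi> (- {-w..w}) = 0}"


section \<open>Sampling processes\<close>

definition sampling_times :: "'w measure \<Rightarrow> (int \<Rightarrow> 'w \<Rightarrow> real) \<Rightarrow> bool"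
  where "sampling_times M t \<longleftrightarrow> prob_space M \<and> (\<forall>n. t n \<in> borel_measurable M)"

definition law :: "'w measure \<Rightarrow> (int \<Rightarrow> 'w \<Rightarrow> real) \<Rightarrow> (int \<Rightarrow> real) measure"
  where "law M t = distr M (\<Pi>\<^sub>M n\<in>UNIV. borel) (\<lambda>\<omega> n. t n \<omega>)"

definition num_points :: "(int \<Rightarrow> 'w \<Rightarrow> real) \<Rightarrow> real set \<Rightarrow> 'w \<Rightarrow> ennreal"
  where "num_points t B \<omega> = emeasure (count_space UNIV) {n. t n \<omega> \<in> B}"

text \<open>
  Stationarity is strict stationarity of the counting process \<open>B \<mapsto> N(B)\<close>. It does not refer
  to the enumeration of the points: no normalisation such as \<open>t 0 \<le> 0 < t 1\<close> is imposed
  (under such a normalisation the interval covering the origin would be size-biased).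
\<close>

definition stationary_points :: "'w measure \<Rightarrow> (int \<Rightarrow> 'w \<Rightarrow> real) \<Rightarrow> bool"
  where "stationary_points M t \<longleftrightarrow>
    (\<forall>I x. finite I \<and> I \<subseteq> bounded_borel \<longrightarrow>
      distr M (\<Pi>\<^sub>M B\<in>I. borel) (\<lambda>\<omega>. \<lambda>B\<in>I. num_points t ((\<lambda>y. y + x) ` B) \<omega>) =
      distr M (\<Pi>\<^sub>M B\<in>I. borel) (\<lambda>\<omega>. \<lambda>B\<in>I. num_points t B \<omega>))"

definition orderly_points :: "'w measure \<Rightarrow> (int \<Rightarrow> 'w \<Rightarrow> real) \<Rightarrow> bool"
  where "orderly_points M t \<longleftrightarrow>
    (\<forall>x. (\<lambda>h. measure M {\<omega> \<in> space M. num_points t {x<..x + h} \<omega> \<ge> 2})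
      \<in> o[at_right 0](\<lambda>h. h))"

definition second_order_points :: "'w measure \<Rightarrow> (int \<Rightarrow> 'w \<Rightarrow> real) \<Rightarrow> bool"
  where "second_order_points M t \<longleftrightarrow>
    (\<forall>B\<in>bounded_borel. (\<integral>\<^sup>+\<omega>. (num_points t B \<omega>)\<^sup>2 \<partial>M) < \<infinity>)"

definition separated_points :: "'w measure \<Rightarrow> (int \<Rightarrow> 'w \<Rightarrow> real) \<Rightarrow> real \<Rightarrow> bool"
  where "separated_points M t d \<longleftrightarrow> (AE \<omega> in M. \<forall>n. t (n + 1) \<omega> - t n \<omega> \<ge> d)"

definition spacing :: "(int \<Rightarrow> 'w \<Rightarrow> real) \<Rightarrow> int \<Rightarrow> 'w \<Rightarrow> real"
  where "spacing t n \<omega> = t (n + 1) \<omega> - t n \<omega>"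

definition renewal_sampling :: "'w measure \<Rightarrow> (int \<Rightarrow> 'w \<Rightarrow> real) \<Rightarrow> bool"
  where "renewal_sampling M t \<longleftrightarrow>
    prob_space.indep_vars M (\<lambda>_. borel) (spacing t) UNIV \<and>
    (\<forall>m n. distr M borel (spacing t m) = distr M borel (spacing t n))"


section \<open>Independent sampling and the compound process\<close>

text \<open>
  Independence of the sampling times from the process. For \<open>X (t n)\<close> to be a random variable
  determined by the two independent sources, \<open>X\<close> has to be a measurable process, and jointly
  measurable with respect to a sigma-algebra \<open>G\<close> that is itself independent of the times.
  Joint measurability with respect to \<open>P\<close> together with independence of all the \<open>X u\<close> would
  not do: with \<open>X u = indicator {u} (t 0)\<close> and \<open>t 0\<close> diffuse, every \<open>X u\<close> is almost surely
  \<open>0\<close>, but \<open>X (t 0) = 1\<close>.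
\<close>

definition independent_sampling ::
    "'p measure \<Rightarrow> (int \<Rightarrow> 'p \<Rightarrow> real) \<Rightarrow> (real \<Rightarrow> 'p \<Rightarrow> real) \<Rightarrow> bool"
  where "independent_sampling P t X \<longleftrightarrow>
    (\<exists>G. subalgebra P G \<and>
      (\<lambda>(u, \<omega>). X u \<omega>) \<in> borel_measurable (borel \<Otimes>\<^sub>M G) \<and>
      prob_space.indep_set P
        (sets (vimage_algebra (space P) (\<lambda>\<omega> n. t n \<omega>) (\<Pi>\<^sub>M n\<in>UNIV. borel))) (sets G))"

definition compound_process ::
    "(int \<Rightarrow> 'p \<Rightarrow> real) \<Rightarrow> (real \<Rightarrow> 'p \<Rightarrow> real) \<Rightarrow> real set \<Rightarrow> 'p \<Rightarrow> real"
  where "compound_process t X B \<omega> = (\<Sum>n | t n \<omega> \<in> B. X (t n \<omega>) \<omega>)"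

definition covariance :: "'p measure \<Rightarrow> ('p \<Rightarrow> real) \<Rightarrow> ('p \<Rightarrow> real) \<Rightarrow> real"
  where "covariance P U V =
    (LINT \<omega>|P. (U \<omega> - (LINT \<omega>'|P. U \<omega>')) * (V \<omega> - (LINT \<omega>'|P. V \<omega>')))"

text \<open>
  Reduced covariance measures are signed and in general only finite on bounded sets; they are
  represented by set functions, of which only the values on bounded Borel sets are relevant.
\<close>

definition signed_measure_on_bounded :: "(real set \<Rightarrow> real) \<Rightarrow> bool"
  where "signed_measure_on_bounded \<mu> \<longleftrightarrow>
    (\<forall>A :: nat \<Rightarrow> real set. range A \<subseteq> sets borel \<and> disjoint_family A \<and> bounded (\<Union>i. A i) \<longrightarrow>
      (\<lambda>i. \<mu> (A i)) sums \<mu> (\<Union>i. A i))"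

definition is_reduced_covariance_measure ::
    "'p measure \<Rightarrow> (real set \<Rightarrow> 'p \<Rightarrow> real) \<Rightarrow> (real set \<Rightarrow> real) \<Rightarrow> bool"
  where "is_reduced_covariance_measure P W \<mu> \<longleftrightarrow>
    (\<forall>B\<in>bounded_borel. W B \<in> borel_measurable P \<and> integrable P (\<lambda>\<omega>. (W B \<omega>)\<^sup>2)) \<and>
    signed_measure_on_bounded \<mu> \<and>
    (\<forall>A\<in>bounded_borel. \<forall>B\<in>bounded_borel.
      set_integrable lborel A (\<lambda>x. \<mu> ((\<lambda>y. y - x) ` B)) \<and>
      covariance P (W A) (W B) = (LINT x:A|lborel. \<mu> ((\<lambda>y. y - x) ` B)))"


section \<open>Alias-free sampling\<close>

text \<open>
  \<open>sampled_with_spectrum M t P s X \<Phi>\<close>: on the probability space \<open>P\<close> live a process \<open>X\<close> with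
  spectrum \<open>\<Phi>\<close> and, independent of it, a version \<open>s\<close> of the sampling times \<open>t\<close>. Passing to a
  version keeps the class of processes that can be sampled from depending on how rich the
  space \<open>M\<close> is; the case \<open>P = M\<close>, \<open>s = t\<close> is included.
\<close>

definition sampled_with_spectrum ::
    "'w measure \<Rightarrow> (int \<Rightarrow> 'w \<Rightarrow> real) \<Rightarrow>
     'p measure \<Rightarrow> (int \<Rightarrow> 'p \<Rightarrow> real) \<Rightarrow> (real \<Rightarrow> 'p \<Rightarrow> real) \<Rightarrow> real measure \<Rightarrow> bool"
  where "sampled_with_spectrum M t P s X \<Phi> \<longleftrightarrow>
    sampling_times P s \<and> law P s = law M t \<and>
    wss_process P X \<and> independent_sampling P s X \<and> is_spectrum P X \<Phi>"

text \<open>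
  The type argument is the type of the sample spaces of the processes, over which one cannot
  quantify inside a definition; it is to be left as a type variable in theorems.
\<close>

definition alias_free ::
    "'p itself \<Rightarrow> 'w measure \<Rightarrow> (int \<Rightarrow> 'w \<Rightarrow> real) \<Rightarrow> real measure set \<Rightarrow> bool"
  where "alias_free (_ :: 'p itself) M t S \<longleftrightarrow>
    \<not> (\<exists>(P :: 'p measure) s X \<Phi> (Q :: 'p measure) r Y \<Psi> \<mu>.
        \<Phi> \<in> S \<and> \<Psi> \<in> S \<and> \<Phi> \<noteq> \<Psi> \<and>
        sampled_with_spectrum M t P s X \<Phi> \<and>
        sampled_with_spectrum M t Q r Y \<Psi> \<and>
        is_reduced_covariance_measure P (compound_process s X) \<mu> \<and>
        is_reduced_covariance_measure Q (compound_process r Y) \<mu>)"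

end

theory Submission
  imports Defs "HOL-Complex_Analysis.Complex_Analysis"
begin

text \<open>
  Let \<open>X\<close> and \<open>Y\<close> have band-limited spectra \<open>\<Phi>\<close> and \<open>\<Psi>\<close>, and let their compound processes have
  the same reduced covariance measure \<open>\<mu>\<close>. The argument works with the unreduced covariances.
  Conditioning on the times, which are independent of \<open>X\<close>, shows that the covariance of \<open>Z(A)\<close>
  and \<open>Z(B)\<close> is the expectation of \<open>\<Sum> C_X (t_m - t_n)\<close> over \<open>t_n \<in> A, t_m \<in> B\<close>
  (\<open>compound_process_covariance\<close>), and this covariance is determined by \<open>\<mu>\<close>. So with
  \<open>D = C_X - C_Y\<close> the expectation of \<open>\<Sum> D (t_m - t_n)\<close> over \<open>t_n \<in> A, t_m \<in> B\<close> vanishes for all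
  bounded Borel sets \<open>A\<close> and \<open>B\<close>.

  Choose \<open>A\<close> and \<open>B\<close> as small intervals for which \<open>D > 0\<close> on all differences. The sum then has
  nonnegative terms and mean zero, so almost surely no pair of points lies in \<open>A \<times> B\<close>; and
  countably many such rectangles cover all pairs whose difference is close to a given \<open>u\<close> with
  \<open>D u > 0\<close>. Hence the spacing \<open>t_1 - t_0\<close> almost surely avoids a neighbourhood of \<open>u\<close>. For
  \<open>u > a\<close> this contradicts the positivity of the spacing density, and by symmetry \<open>D < 0\<close> is
  impossible too: the covariance functions agree on \<open>(a, \<infinity>)\<close>
  (\<open>covariance_le_beyond_if_same_covariance_measure\<close>).

  Finally, the Fourier transform of a measure on a bounded band extends to an entire function, so
  agreement on a half-line is agreement everywhere (\<open>band_limited_char_eq_if_eq_on_half_line\<close>),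
  and a finite measure is determined by its characteristic function.
\<close>

section \<open>Sampling a process at independent times\<close>

text \<open>
  The finite index sets form a countable collection, so the sum is obtained by gluing countably
  many measurable functions. Where the index set is infinite, the sum is \<open>0\<close> by convention.
\<close>

lemma borel_measurable_sum_random_index:
  fixes f :: "'i::countable \<Rightarrow> 'a \<Rightarrow> real"
  assumes [measurable]: "\<And>n. f n \<in> borel_measurable M" "\<And>n. Measurable.pred M (c n)"
  shows "(\<lambda>x. \<Sum>n | c n x. f n x) \<in> borel_measurable M"
proof -
  let ?g = "\<lambda>x. if finite {n. c n x} then {n. c n x} else {}"
  have fin [measurable]: "Measurable.pred M (\<lambda>x. finite {n. c n x})"
  proof -
    have eq: "finite {n. c n x} \<longleftrightarrow> (\<exists>S \<in> Collect finite. \<forall>n. c n x \<longrightarrow> n \<in> S)" for x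
      by (auto intro: finite_subset[of "{n. c n x}"])
    have "countable (Collect finite :: 'i set set)"
      by (rule countable_Collect_finite)
    then show ?thesis
      unfolding eq by measurable
  qed
  have "?g \<in> measurable M (count_space (Collect finite))"
  proof (subst measurable_count_space_eq_countable)
    show "countable (Collect finite :: 'i set set)"
      by (rule countable_Collect_finite)
    have "?g -` {S} \<inter> space M \<in> sets M" for S
    proof -
      have "?g -` {S} \<inter> space M =
          {x \<in> space M. (finite {n. c n x} \<longrightarrow> (\<forall>n. c n x \<longleftrightarrow> n \<in> S)) \<and>
                        (\<not> finite {n. c n x} \<longrightarrow> S = {})}"
        by (auto split: if_splits)
      also have "\<dots> \<in> sets M"
        by measurable
      finally show ?thesis .
    qed
    then show "?g \<in> space M \<rightarrow> Collect finite \<and>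
        (\<forall>S\<in>Collect finite. ?g -` {S} \<inter> space M \<in> sets M)"
      by auto
  qed
  then have "(\<lambda>x. \<Sum>n \<in> ?g x. f n x) \<in> borel_measurable M"
    by (rule measurable_compose_countable'[where f = "\<lambda>S x. \<Sum>n\<in>S. f n x", rotated])
       (auto intro: countable_Collect_finite)
  also have "(\<lambda>x. \<Sum>n \<in> ?g x. f n x) = (\<lambda>x. \<Sum>n | c n x. f n x)"
    by auto
  finally show ?thesis .
qed

text \<open>
  The pair formed by the times and the identity map into \<open>G\<close> has a product law, so the times can
  be held fixed while the remaining randomness is integrated out.
\<close>

lemma independent_times_Fubini:
  fixes F :: "(int \<Rightarrow> real) \<times> 'p \<Rightarrow> real"
  assumes s: "sampling_times P s"
    and G: "subalgebra P G"
    and indep: "prob_space.indep_set P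
        (sets (vimage_algebra (space P) (\<lambda>\<omega> n. s n \<omega>) (\<Pi>\<^sub>M n\<in>UNIV. borel))) (sets G)"
    and F: "F \<in> borel_measurable ((\<Pi>\<^sub>M n\<in>UNIV. borel) \<Otimes>\<^sub>M G)"
    and int: "integrable P (\<lambda>\<omega>. F (\<lambda>n. s n \<omega>, \<omega>))"
  shows "integrable (law P s) (\<lambda>\<tau>. LINT \<omega>|P. F (\<tau>, \<omega>))"
    and "(LINT \<tau>|law P s. LINT \<omega>|P. F (\<tau>, \<omega>)) = (LINT \<omega>|P. F (\<lambda>n. s n \<omega>, \<omega>))"
proof -
  let ?L = "\<Pi>\<^sub>M n\<in>(UNIV :: int set). (borel :: real measure)"
  let ?s = "\<lambda>\<omega> n. s n \<omega>"
  interpret prob_space P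
    using s by (simp add: sampling_times_def)
  have s_meas: "?s \<in> measurable P ?L"
    using s by (intro measurable_PiM_single') (auto simp: sampling_times_def)
  have id_meas: "(\<lambda>\<omega>. \<omega>) \<in> measurable P G"
    using G by (auto simp: subalgebra_def measurable_def)
  interpret L: prob_space "law P s"
    unfolding law_def by (rule prob_space_distr) (rule s_meas)
  interpret R: prob_space "distr P G (\<lambda>\<omega>. \<omega>)"
    by (rule prob_space_distr) (rule id_meas)
  interpret LR: pair_prob_space "law P s" "distr P G (\<lambda>\<omega>. \<omega>)" ..
  have pair_meas: "(\<lambda>\<omega>. (?s \<omega>, \<omega>)) \<in> measurable P (?L \<Otimes>\<^sub>M G)"
    by (rule measurable_Pair[OF s_meas id_meas])
  have prod: "law P s \<Otimes>\<^sub>M distr P G (\<lambda>\<omega>. \<omega>) = distr P (?L \<Otimes>\<^sub>M G) (\<lambda>\<omega>. (?s \<omega>, \<omega>))"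
  proof (rule pair_measure_eqI)
    show "sigma_finite_measure (law P s)" "sigma_finite_measure (distr P G (\<lambda>\<omega>. \<omega>))" ..
    show "sets (law P s \<Otimes>\<^sub>M distr P G (\<lambda>\<omega>. \<omega>)) =
        sets (distr P (?L \<Otimes>\<^sub>M G) (\<lambda>\<omega>. (?s \<omega>, \<omega>)))"
      by (simp add: law_def cong: sets_pair_measure_cong)
    fix A B assume "A \<in> sets (law P s)" "B \<in> sets (distr P G (\<lambda>\<omega>. \<omega>))"
    then have A: "A \<in> sets ?L" and B: "B \<in> sets G"
      by (simp_all add: law_def)
    have B': "B \<inter> space P = B"
      using sets.sets_into_space[OF B] G by (auto simp: subalgebra_def)
    have "prob ((?s -` A \<inter> space P) \<inter> B) = prob (?s -` A \<inter> space P) * prob B"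
      using A B by (intro indep_setD[OF indep]) (auto simp: in_vimage_algebra)
    moreover have "(\<lambda>\<omega>. (?s \<omega>, \<omega>)) -` (A \<times> B) \<inter> space P = (?s -` A \<inter> space P) \<inter> B"
      using B' by auto
    ultimately show "emeasure (law P s) A * emeasure (distr P G (\<lambda>\<omega>. \<omega>)) B =
        emeasure (distr P (?L \<Otimes>\<^sub>M G) (\<lambda>\<omega>. (?s \<omega>, \<omega>))) (A \<times> B)"
      using A B by (simp add: law_def emeasure_distr s_meas id_meas pair_meas B'
          emeasure_eq_measure ennreal_mult)
  qed
  have int': "integrable (law P s \<Otimes>\<^sub>M distr P G (\<lambda>\<omega>. \<omega>)) F"
    unfolding prod using int by (simp add: integrable_distr_eq[OF pair_meas F])
  have inner: "(LINT \<omega>|distr P G (\<lambda>\<omega>. \<omega>). F (\<tau>, \<omega>)) = (LINT \<omega>|P. F (\<tau>, \<omega>))" for \<tau>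
  proof (rule integral_distr[OF id_meas])
    have "\<tau> \<in> space ?L"
      by (simp add: space_PiM)
    then show "(\<lambda>\<omega>. F (\<tau>, \<omega>)) \<in> borel_measurable G"
      by (rule measurable_compose[OF measurable_Pair1' F])
  qed
  show "integrable (law P s) (\<lambda>\<tau>. LINT \<omega>|P. F (\<tau>, \<omega>))"
    using LR.integrable_fst'[OF int'] by (simp add: inner)
  have "(LINT \<tau>|law P s. LINT \<omega>|P. F (\<tau>, \<omega>)) = integral\<^sup>L (distr P (?L \<Otimes>\<^sub>M G) (\<lambda>\<omega>. (?s \<omega>, \<omega>))) F"
    using LR.integral_fst'[OF int'] by (simp add: inner prod)
  also have "\<dots> = (LINT \<omega>|P. F (\<lambda>n. s n \<omega>, \<omega>))"
    by (rule integral_distr[OF pair_meas F])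
  finally show "(LINT \<tau>|law P s. LINT \<omega>|P. F (\<tau>, \<omega>)) = (LINT \<omega>|P. F (\<lambda>n. s n \<omega>, \<omega>))" .
qed

lemma integrable_mult_if_square_integrable:
  fixes f g :: "'a \<Rightarrow> real"
  assumes "f \<in> borel_measurable M" "integrable M (\<lambda>x. (f x)\<^sup>2)"
    and "g \<in> borel_measurable M" "integrable M (\<lambda>x. (g x)\<^sup>2)"
  shows "integrable M (\<lambda>x. f x * g x)"
proof (rule Bochner_Integration.integrable_bound)
  show "integrable M (\<lambda>x. (f x)\<^sup>2 + (g x)\<^sup>2)"
    using assms by simp
  have "\<bar>x * y\<bar> \<le> x\<^sup>2 + y\<^sup>2" for x y :: real
    using sum_squares_bound[of "\<bar>x\<bar>" "\<bar>y\<bar>"] abs_ge_zero[of "x * y"]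
    unfolding abs_mult power2_abs by linarith
  then show "AE x in M. norm (f x * g x) \<le> norm ((f x)\<^sup>2 + (g x)\<^sup>2)"
    by simp
qed (use assms in simp)

lemma wss_process_mixed_moment:
  assumes "wss_process P X"
  shows "integrable P (\<lambda>\<omega>. X u \<omega> * X v \<omega>)"
    and "(LINT \<omega>|P. X u \<omega> * X v \<omega>) = covariance_function P X (v - u)"
proof -
  have meas: "\<And>u. X u \<in> borel_measurable P"
    and sq: "\<And>u. integrable P (\<lambda>\<omega>. (X u \<omega>)\<^sup>2)"
    and stat: "\<And>s u v. (LINT \<omega>|P. X (s + u) \<omega> * X s \<omega>) = (LINT \<omega>|P. X (v + u) \<omega> * X v \<omega>)"
    using assms by (auto simp: wss_process_def)
  show "integrable P (\<lambda>\<omega>. X u \<omega> * X v \<omega>)"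
    by (intro integrable_mult_if_square_integrable meas sq)
  show "(LINT \<omega>|P. X u \<omega> * X v \<omega>) = covariance_function P X (v - u)"
    using stat[of u "v - u" 0] by (simp add: covariance_function_def mult.commute)
qed

definition pair_sum :: "(real \<Rightarrow> real) \<Rightarrow> real set \<Rightarrow> real set \<Rightarrow> (int \<Rightarrow> real) \<Rightarrow> real"
  where "pair_sum g A B \<tau> = (\<Sum>n | \<tau> n \<in> A. \<Sum>m | \<tau> m \<in> B. g (\<tau> m - \<tau> n))"

text \<open>
  Given the times, the compound process is a finite sum of values of the observed process, so
  its conditional mean is zero and its conditional mixed moments are finite sums of values of the
  covariance function. This holds even for times that accumulate in \<open>A\<close> or \<open>B\<close>, because sums over
  infinite index sets vanish by convention on both sides.
\<close>

lemma compound_process_covariance: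
  assumes s: "sampling_times P s" and X: "wss_process P X" and ind: "independent_sampling P s X"
    and A: "A \<in> sets borel" and B: "B \<in> sets borel"
    and ZA: "compound_process s X A \<in> borel_measurable P"
      "integrable P (\<lambda>\<omega>. (compound_process s X A \<omega>)\<^sup>2)"
    and ZB: "compound_process s X B \<in> borel_measurable P"
      "integrable P (\<lambda>\<omega>. (compound_process s X B \<omega>)\<^sup>2)"
  shows "integrable (law P s) (pair_sum (covariance_function P X) A B)"
    and "(LINT \<tau>|law P s. pair_sum (covariance_function P X) A B \<tau>) =
      covariance P (compound_process s X A) (compound_process s X B)"
proof -
  interpret prob_space P
    using s by (simp add: sampling_times_def)
  obtain G where G: "subalgebra P G"
    and XG: "(\<lambda>(u, \<omega>). X u \<omega>) \<in> borel_measurable (borel \<Otimes>\<^sub>M G)"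
    and indep: "indep_set
        (sets (vimage_algebra (space P) (\<lambda>\<omega> n. s n \<omega>) (\<Pi>\<^sub>M n\<in>UNIV. borel))) (sets G)"
    using ind by (auto simp: independent_sampling_def)
  let ?L = "\<Pi>\<^sub>M n\<in>(UNIV :: int set). (borel :: real measure)"
  define Z where "Z = (\<lambda>E (\<tau> :: int \<Rightarrow> real, \<omega>). \<Sum>n | \<tau> n \<in> E. X (\<tau> n) \<omega>)"
  have Z_apply: "Z E (\<lambda>n. s n \<omega>, \<omega>) = compound_process s X E \<omega>" for E \<omega>
    by (simp add: Z_def compound_process_def)
  have Z_meas: "Z E \<in> borel_measurable (?L \<Otimes>\<^sub>M G)" if [measurable]: "E \<in> sets borel" for E
  proof -
    have "(\<lambda>p. X (fst p n) (snd p)) \<in> borel_measurable (?L \<Otimes>\<^sub>M G)" for n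
      using measurable_compose[OF _ XG, of "\<lambda>p. (fst p n, snd p)" "?L \<Otimes>\<^sub>M G"] by simp
    moreover have "Measurable.pred (?L \<Otimes>\<^sub>M G) (\<lambda>p. fst p n \<in> E)" for n
      by measurable
    ultimately show ?thesis
      unfolding Z_def case_prod_beta by (rule borel_measurable_sum_random_index)
  qed
  have X_int: "integrable P (X u)" and X_mean: "(LINT \<omega>|P. X u \<omega>) = 0" for u
  proof -
    have "X u \<in> borel_measurable P" "integrable P (\<lambda>\<omega>. (X u \<omega>)\<^sup>2)"
      using X by (auto simp: wss_process_def)
    then show "integrable P (X u)"
      by (rule square_integrable_imp_integrable)
    show "(LINT \<omega>|P. X u \<omega>) = 0"
      using X by (auto simp: wss_process_def)
  qed
  have mean: "(LINT \<omega>|P. compound_process s X E \<omega>) = 0"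
    if "E \<in> sets borel" "integrable P (compound_process s X E)" for E
  proof -
    have "(LINT \<omega>|P. Z E (\<tau>, \<omega>)) = 0" for \<tau>
      by (simp add: Z_def Bochner_Integration.integral_sum X_int X_mean)
    then show ?thesis
      using independent_times_Fubini(2)[OF s G indep Z_meas[OF that(1)]] that(2)
      by (simp add: Z_apply)
  qed
  have int: "integrable P (compound_process s X A)" "integrable P (compound_process s X B)"
    using ZA ZB by (auto intro: square_integrable_imp_integrable)
  have "integrable P (\<lambda>\<omega>. compound_process s X A \<omega> * compound_process s X B \<omega>)"
    by (intro integrable_mult_if_square_integrable ZA ZB)
  then have int2: "integrable P (\<lambda>\<omega>. (\<lambda>p. Z A p * Z B p) (\<lambda>n. s n \<omega>, \<omega>))"
    by (simp add: Z_apply)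
  have inner: "(LINT \<omega>|P. Z A (\<tau>, \<omega>) * Z B (\<tau>, \<omega>)) = pair_sum (covariance_function P X) A B \<tau>"
    for \<tau>
    by (simp add: Z_def sum_product pair_sum_def Bochner_Integration.integral_sum
        wss_process_mixed_moment[OF X])
  have ZZ: "(\<lambda>p. Z A p * Z B p) \<in> borel_measurable (?L \<Otimes>\<^sub>M G)"
    using A B by (intro borel_measurable_times Z_meas)
  show "integrable (law P s) (pair_sum (covariance_function P X) A B)"
    using independent_times_Fubini(1)[OF s G indep ZZ int2] by (simp add: inner)
  show "(LINT \<tau>|law P s. pair_sum (covariance_function P X) A B \<tau>) =
      covariance P (compound_process s X A) (compound_process s X B)"
    using independent_times_Fubini(2)[OF s G indep ZZ int2] mean[OF A int(1)] mean[OF B int(2)]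
    by (simp add: inner Z_apply covariance_def)
qed

section \<open>Band-limited spectra\<close>

definition fourier_extension :: "real measure \<Rightarrow> complex \<Rightarrow> complex"
  where "fourier_extension \<Phi> z = (CLINT x|\<Phi>. exp (\<i> * z * of_real x))"

lemma fourier_extension_of_real: "fourier_extension \<Phi> (of_real u) = char \<Phi> u"
  by (simp add: fourier_extension_def char_def mult.assoc)

text \<open>
  On a bounded band, the exponential series may be integrated term by term.
\<close>

lemma fourier_extension_entire:
  assumes "\<Phi> \<in> band_limited_spectra w"
  shows "fourier_extension \<Phi> holomorphic_on UNIV"
proof -
  have fb: "finite_borel_measure \<Phi>" and supp: "emeasure \<Phi> (- {-w..w}) = 0"
    using assms by (auto simp: band_limited_spectra_def)
  interpret finite_borel_measure \<Phi> by (rule fb)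
  have [measurable_cong]: "sets \<Phi> = sets borel" by (rule M_is_borel)
  have AE_w: "AE x in \<Phi>. \<bar>x\<bar> \<le> w"
  proof (rule AE_I[OF _ supp])
    show "- {- w..w} \<in> sets \<Phi>" by (simp add: M_is_borel)
    show "{x \<in> space \<Phi>. \<not> \<bar>x\<bar> \<le> w} \<subseteq> - {- w..w}" by auto
  qed
  define b where "b = (\<lambda>n. CLINT x|\<Phi>. (\<i> * of_real x) ^ n / fact n)"
  have sums: "(\<lambda>n. b n * z ^ n) sums fourier_extension \<Phi> z" for z
  proof -
    let ?f = "\<lambda>n x. (\<i> * z * of_real x) ^ n / fact n :: complex"
    let ?c = "\<lambda>n. (cmod z * w) ^ n / fact n"
    have bound: "AE x in \<Phi>. norm (?f n x) \<le> ?c n" for n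
      using AE_w
      by eventually_elim
        (auto simp: norm_power norm_mult norm_divide intro!: divide_right_mono power_mono mult_left_mono)
    have int: "integrable \<Phi> (?f n)" for n
      by (rule integrable_const_bound[OF bound]) measurable
    have "summable (\<lambda>n. LINT x|\<Phi>. norm (?f n x))"
    proof (rule summable_comparison_test')
      show "summable (\<lambda>n. measure \<Phi> (space \<Phi>) * ?c n)"
        using summable_exp_generic[of "cmod z * w"] 
        by (intro summable_mult) (simp add: field_simps scaleR_conv_of_real)
      fix n
      have "(LINT x|\<Phi>. norm (?f n x)) \<le> (LINT x|\<Phi>. ?c n)"
        by (rule integral_mono_AE) (use int bound in auto)
      then show "norm (LINT x|\<Phi>. norm (?f n x)) \<le> measure \<Phi> (space \<Phi>) * ?c n"
        by simp
    qed
    moreover have ser: "?f n x = ((\<i> * z * of_real x) ^ n) /\<^sub>R fact n" for n x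
      by (simp add: scaleR_conv_of_real field_simps)
    have "AE x in \<Phi>. summable (\<lambda>n. norm (?f n x))"
      unfolding ser by (intro AE_I2 summable_norm_exp)
    ultimately have "(\<lambda>n. integral\<^sup>L \<Phi> (?f n)) sums (CLINT x|\<Phi>. \<Sum>n. ?f n x)"
      using int by (intro sums_integral)
    moreover have "(\<Sum>n. ?f n x) = exp (\<i> * z * of_real x)" for x
      unfolding ser exp_def ..
    moreover have "integral\<^sup>L \<Phi> (?f n) = b n * z ^ n" for n
      unfolding b_def by (subst integral_mult_left_zero[symmetric]) (simp add: power_mult_distrib mult_ac)
    ultimately show ?thesis
      by (simp add: fourier_extension_def)
  qed
  have "fourier_extension \<Phi> holomorphic_on ball 0 r" for r
    by (rule power_series_holomorphic[where a = b]) (use sums in simp)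
  then have "fourier_extension \<Phi> field_differentiable at z" for z
    by (rule holomorphic_on_imp_differentiable_at[of _ "ball 0 (norm z + 1)"]) auto
  then show ?thesis
    by (simp add: holomorphic_on_def field_differentiable_at_within)
qed

text \<open>
  The identity theorem applies to the entire extensions, the half-line being full of
  accumulation points.
\<close>

lemma band_limited_char_eq_if_eq_on_half_line:
  assumes "\<Phi> \<in> band_limited_spectra w" "\<Psi> \<in> band_limited_spectra w"
    and eq: "\<And>u. u > a \<Longrightarrow> char \<Phi> u = char \<Psi> u"
  shows "char \<Phi> = char \<Psi>"
proof
  fix u
  let ?h = "\<lambda>z. fourier_extension \<Phi> z - fourier_extension \<Psi> z"
  have "?h (of_real u) = 0"
  proof (rule analytic_continuation[where f = ?h and S = UNIV and U = "complex_of_real ` {a<..}"])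
    show "?h holomorphic_on UNIV"
      using assms by (intro holomorphic_on_diff fourier_extension_entire)
    show "complex_of_real (a + 1) islimpt complex_of_real ` {a<..}"
    proof (unfold islimpt_approachable, intro allI impI)
      fix e :: real assume "e > 0"
      then show "\<exists>z\<in>complex_of_real ` {a<..}. z \<noteq> complex_of_real (a + 1) \<and>
          dist z (complex_of_real (a + 1)) < e"
        by (intro bexI[of _ "complex_of_real (a + 1 + e / 2)"])
           (auto simp: dist_of_real dist_real_def simp del: of_real_add)
    qed
    show "?h z = 0" if "z \<in> complex_of_real ` {a<..}" for z
      using that eq by (auto simp: fourier_extension_of_real)
  qed auto
  then show "char \<Phi> u = char \<Psi> u"
    by (simp add: fourier_extension_of_real)
qed

text \<open>
  The value of the characteristic function at the origin is the total mass, so the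
  uniqueness theorem for probability measures applies after normalisation.
\<close>

lemma finite_borel_measure_char_unique:
  assumes \<Phi>: "finite_borel_measure \<Phi>" and \<Psi>: "finite_borel_measure \<Psi>"
    and eq: "char \<Phi> = char \<Psi>"
  shows "\<Phi> = \<Psi>"
proof -
  let ?m = "measure \<Phi> UNIV"
  have sets: "sets \<Phi> = sets borel" "sets \<Psi> = sets borel"
    and fin: "finite_measure \<Phi>" "finite_measure \<Psi>"
    using \<Phi> \<Psi> by (simp_all add: finite_borel_measure_def finite_borel_measure_axioms_def)
  have space: "space \<Phi> = UNIV" "space \<Psi> = UNIV"
    using sets_eq_imp_space_eq[OF sets(1)] sets_eq_imp_space_eq[OF sets(2)] by simp_all
  have "complex_of_real ?m = complex_of_real (measure \<Psi> UNIV)"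
    using fun_cong[OF eq, of 0] by (simp add: char_def space)
  then have m: "measure \<Psi> UNIV = ?m"
    by simp
  show ?thesis
  proof (cases "?m = 0")
    case True
    have "emeasure N A = 0" if "finite_measure N" "space N = UNIV" "measure N UNIV = 0"
      for N :: "real measure" and A
      using that finite_measure.emeasure_eq_measure[OF that(1), of UNIV] emeasure_space[of N A]
      by simp
    then show ?thesis
      using True m fin space sets by (intro measure_eqI) auto
  next
    case False
    then have m_pos: "?m > 0"
      by (simp add: zero_less_measure_iff measure_nonneg order.not_eq_order_implies_strict)
    let ?n = "\<lambda>N. density N (\<lambda>_. ennreal (1 / ?m))"
    have dist: "real_distribution (?n N)"
      if "finite_measure N" "space N = UNIV" "sets N = sets borel" "measure N UNIV = ?m" for N
    proof -
      have "emeasure (?n N) UNIV = 1"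
        using that m_pos sets.top[of N]
        by (simp add: emeasure_density_const finite_measure.emeasure_eq_measure
            ennreal_mult[symmetric])
      then have "prob_space (?n N)"
        using that by (intro prob_spaceI) simp
      then show ?thesis
        using that by (simp add: real_distribution_def real_distribution_axioms_def)
    qed
    have char_n: "char (?n N) u = complex_of_real (1 / ?m) * char N u"
      if "sets N = sets borel" for N u
    proof -
      have [measurable_cong]: "sets N = sets borel" by (rule that)
      have "char (?n N) u = (CLINT x|N. (1 / ?m) *\<^sub>R iexp (u * x))"
        unfolding char_def by (rule integral_density) (auto simp: m_pos less_imp_le)
      also have "\<dots> = (1 / ?m) *\<^sub>R (CLINT x|N. iexp (u * x))"
        by (rule integral_scaleR_right)
      finally show ?thesis
        by (simp add: char_def scaleR_conv_of_real)
    qed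
    have "?n \<Phi> = ?n \<Psi>"
      using dist[OF fin(1) space(1) sets(1) refl] dist[OF fin(2) space(2) sets(2) m] eq
      by (intro Levy_uniqueness) (auto simp: char_n sets)
    then have "density (?n \<Phi>) (\<lambda>_. ennreal ?m) = density (?n \<Psi>) (\<lambda>_. ennreal ?m)"
      by simp
    then show ?thesis
      using m_pos by (simp add: density_density_eq ennreal_mult[symmetric] density_1)
  qed
qed

section \<open>Equal covariance measures force equal spectra\<close>

lemma finite_separated_points_in_bounded:
  fixes \<tau> :: "int \<Rightarrow> real"
  assumes "d > 0" and gap: "\<And>n. \<tau> (n + 1) - \<tau> n \<ge> d" and "bounded A"
  shows "finite {n. \<tau> n \<in> A}"
proof -
  have step: "\<tau> (n + int k) - \<tau> n \<ge> d * real k" for n :: int and k :: nat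
  proof (induction k)
    case (Suc k)
    then show ?case
      using gap[of "n + int k"] by (simp add: algebra_simps)
  qed simp
  have far: "d * \<bar>real_of_int n\<bar> \<le> \<bar>\<tau> n - \<tau> 0\<bar>" for n
    using step[of "nat n" 0] step[of "nat (- n)" n] by (cases "n \<ge> 0") auto
  obtain K where K: "\<And>x. x \<in> A \<Longrightarrow> \<bar>x\<bar> \<le> K"
    using \<open>bounded A\<close> by (auto simp: bounded_iff)
  let ?r = "(K + \<bar>\<tau> 0\<bar>) / d"
  have "{n. \<tau> n \<in> A} \<subseteq> {- \<lceil>?r\<rceil>..\<lceil>?r\<rceil>}"
  proof
    fix n assume "n \<in> {n. \<tau> n \<in> A}"
    then have "d * \<bar>real_of_int n\<bar> \<le> K + \<bar>\<tau> 0\<bar>"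
      using far[of n] K[of "\<tau> n"] by auto
    then have "\<bar>real_of_int n\<bar> \<le> ?r"
      using \<open>d > 0\<close> by (simp add: field_simps)
    then show "n \<in> {- \<lceil>?r\<rceil>..\<lceil>?r\<rceil>}"
      by (simp add: abs_le_iff) linarith
  qed
  then show ?thesis
    by (rule finite_subset) simp
qed

lemma pair_sum_diff: "pair_sum g A B \<tau> - pair_sum h A B \<tau> = pair_sum (\<lambda>u. g u - h u) A B \<tau>"
  by (simp add: pair_sum_def sum_subtractf)

lemma no_pairs_if_pair_sum_null:
  assumes fin: "finite {n. \<tau> n \<in> A}" "finite {m. \<tau> m \<in> B}"
    and pos: "\<And>x y. x \<in> A \<Longrightarrow> y \<in> B \<Longrightarrow> g (y - x) > 0"
    and null: "pair_sum g A B \<tau> = 0"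
  shows "\<not> (\<tau> n \<in> A \<and> \<tau> m \<in> B)"
proof
  assume nm: "\<tau> n \<in> A \<and> \<tau> m \<in> B"
  have inner: "(\<Sum>m | \<tau> m \<in> B. g (\<tau> m - \<tau> k)) > 0" if "\<tau> k \<in> A" for k
  proof (rule sum_pos)
    show "g (\<tau> i - \<tau> k) > 0" if "i \<in> {m. \<tau> m \<in> B}" for i
      using that \<open>\<tau> k \<in> A\<close> by (intro pos) auto
  qed (use nm fin in auto)
  have "pair_sum g A B \<tau> > 0"
    unfolding pair_sum_def
  proof (rule sum_pos)
    show "(\<Sum>m | \<tau> m \<in> B. g (\<tau> m - \<tau> k)) > 0" if "k \<in> {n. \<tau> n \<in> A}" for k
      using that by (intro inner) auto
  qed (use nm fin in auto)
  then show False
    using null by simp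
qed

text \<open>
  Around a point where \<open>D\<close> is positive, sums of \<open>D\<close> with mean zero leave no room for spacings. The
  separation of the points enters through the finiteness of their number in a bounded set;
  for infinitely many points the sum would be \<open>0\<close> without excluding any pair.
\<close>

lemma AE_spacing_not_near_if_pair_sums_null:
  assumes tm: "sampling_times M t" and "d > 0" and sep: "separated_points M t d"
    and pos: "\<And>v. \<bar>v - u\<bar> < 2 * e \<Longrightarrow> D v > 0" and "e > 0"
    and int: "\<And>A B. A \<in> bounded_borel \<Longrightarrow> B \<in> bounded_borel \<Longrightarrow> integrable (law M t) (pair_sum D A B)"
    and null: "\<And>A B. A \<in> bounded_borel \<Longrightarrow> B \<in> bounded_borel \<Longrightarrow>
      (LINT \<tau>|law M t. pair_sum D A B \<tau>) = 0"
  shows "AE \<omega> in M. \<not> \<bar>spacing t 0 \<omega> - u\<bar> < e"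
proof -
  \<comment> \<open>Two boxes of widths \<open>e\<close> and \<open>3 * e\<close>: if the first point is in the former and the spacing
      differs from \<open>u\<close> by less than \<open>e\<close>, the second point is in the latter; and all differences
      between the boxes stay where \<open>D\<close> is positive.\<close>
  define I where "I q = {q - e / 2<..<q + e / 2}" for q
  define J where "J q = {q + u - 3 / 2 * e<..<q + u + 3 / 2 * e}" for q
  have IJ: "I q \<in> bounded_borel" "J q \<in> bounded_borel" for q
    by (auto simp: I_def J_def bounded_borel_def)
  have t_meas: "(\<lambda>\<omega> n. t n \<omega>) \<in> measurable M (\<Pi>\<^sub>M n\<in>UNIV. borel)"
    using tm by (intro measurable_PiM_single') (auto simp: sampling_times_def)
  have D_pos: "D (y - x) > 0" if "x \<in> I q" "y \<in> J q" for x y q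
    using that by (intro pos) (auto simp: I_def J_def)
  have fin: "AE \<omega> in M. \<forall>A. bounded A \<longrightarrow> finite {n. t n \<omega> \<in> A}"
    using sep[unfolded separated_points_def] 
    by eventually_elim (auto intro!: finite_separated_points_in_bounded[OF \<open>d > 0\<close>])
  have "AE \<omega> in M. \<not> (t 0 \<omega> \<in> I q \<and> t 1 \<omega> \<in> J q)" for q
  proof -
    have meas: "pair_sum D (I q) (J q) \<in> borel_measurable (\<Pi>\<^sub>M n\<in>UNIV. borel)"
      using borel_measurable_integrable[OF int[OF IJ(1)[of q] IJ(2)[of q]]] by (simp add: law_def)
    have int': "integrable M (\<lambda>\<omega>. pair_sum D (I q) (J q) (\<lambda>n. t n \<omega>))"
      using int[OF IJ(1)[of q] IJ(2)[of q]] unfolding law_def by (simp add: integrable_distr_eq[OF t_meas meas])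
    have "(LINT \<omega>|M. pair_sum D (I q) (J q) (\<lambda>n. t n \<omega>)) = 0"
      using null[OF IJ(1)[of q] IJ(2)[of q]] unfolding law_def by (simp add: integral_distr[OF t_meas meas])
    moreover have "pair_sum D (I q) (J q) \<tau> \<ge> 0" for \<tau>
      unfolding pair_sum_def using D_pos by (intro sum_nonneg) (auto intro: less_imp_le)
    ultimately have "AE \<omega> in M. pair_sum D (I q) (J q) (\<lambda>n. t n \<omega>) = 0"
      using integral_nonneg_eq_0_iff_AE[OF int'] by simp
    then show ?thesis
      using fin
    proof eventually_elim
      case (elim \<omega>)
      then show ?case
        using IJ[of q] D_pos[of _ q]
        by (intro no_pairs_if_pair_sum_null[where g = D]) (auto simp: bounded_borel_def)
    qed
  qed
  then have "AE \<omega> in M. \<forall>q\<in>\<rat>. \<not> (t 0 \<omega> \<in> I q \<and> t 1 \<omega> \<in> J q)"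
    by (intro AE_ball_countable' countable_rat)
  then show ?thesis
  proof eventually_elim
    case (elim \<omega>)
    show ?case
    proof
      assume near: "\<bar>spacing t 0 \<omega> - u\<bar> < e"
      obtain q where "q \<in> \<rat>" "t 0 \<omega> - e / 2 < q" "q < t 0 \<omega> + e / 2"
        using Rats_dense_in_real[of "t 0 \<omega> - e / 2" "t 0 \<omega> + e / 2"] \<open>e > 0\<close> by auto
      then show False
        using elim near by (auto simp: I_def J_def spacing_def abs_less_iff)
    qed
  qed
qed

lemma not_AE_avoids_if_density_pos:
  assumes S: "distributed M lborel S f" and "e > 0"
    and pos: "\<And>v. \<bar>v - u\<bar> < e \<Longrightarrow> f v > (0 :: ennreal)"
  shows "\<not> (AE \<omega> in M. \<not> \<bar>S \<omega> - (u :: real)\<bar> < e)"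
proof
  assume "AE \<omega> in M. \<not> \<bar>S \<omega> - u\<bar> < e"
  have [measurable]: "S \<in> borel_measurable M" "f \<in> borel_measurable borel"
    using distributed_measurable[OF S] distributed_borel_measurable[OF S] by auto
  have "AE v in density lborel f. \<not> \<bar>v - u\<bar> < e"
    unfolding distributed_distr_eq_density[OF S, symmetric]
    by (subst AE_distr_iff) (use \<open>AE \<omega> in M. \<not> \<bar>S \<omega> - u\<bar> < e\<close> in auto)
  then have "AE v in lborel. \<not> \<bar>v - u\<bar> < e"
    by (subst (asm) AE_density) (use pos in auto)
  then have "emeasure lborel {u - e<..<u + e} = 0"
    by (subst (asm) AE_iff_measurable[where N = "{u - e<..<u + e}"])
       (auto simp: abs_less_iff algebra_simps)
  then show False
    using \<open>e > 0\<close> by simp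
qed

text \<open>
  The right-hand side depends on \<open>\<mu>\<close> alone, and the law on the left is that of \<open>t\<close>, not of its
  version \<open>s\<close>. This makes processes living on different probability spaces comparable.
\<close>

lemma covariance_measure_determines_pair_sums:
  assumes X: "sampled_with_spectrum M t P s X \<Phi>"
    and \<mu>: "is_reduced_covariance_measure P (compound_process s X) \<mu>"
    and A: "A \<in> bounded_borel" and B: "B \<in> bounded_borel"
  shows "integrable (law M t) (pair_sum (covariance_function P X) A B)"
    and "(LINT \<tau>|law M t. pair_sum (covariance_function P X) A B \<tau>) =
      (LINT x:A|lborel. \<mu> ((\<lambda>y. y - x) ` B))"
proof -
  have s: "sampling_times P s" "wss_process P X" "independent_sampling P s X"
    and law: "law P s = law M t"
    using X by (auto simp: sampled_with_spectrum_def)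
  have borel: "A \<in> sets borel" "B \<in> sets borel"
    using A B by (auto simp: bounded_borel_def)
  have Z: "compound_process s X E \<in> borel_measurable P"
    "integrable P (\<lambda>\<omega>. (compound_process s X E \<omega>)\<^sup>2)" if "E \<in> bounded_borel" for E
    using \<mu> that by (auto simp: is_reduced_covariance_measure_def)
  have cov: "covariance P (compound_process s X A) (compound_process s X B) =
      (LINT x:A|lborel. \<mu> ((\<lambda>y. y - x) ` B))"
    using \<mu> A B by (auto simp: is_reduced_covariance_measure_def)
  note moments = compound_process_covariance[OF s borel Z[OF A] Z[OF B], unfolded law cov]
  show "integrable (law M t) (pair_sum (covariance_function P X) A B)"
    by (rule moments(1))
  show "(LINT \<tau>|law M t. pair_sum (covariance_function P X) A B \<tau>) =
      (LINT x:A|lborel. \<mu> ((\<lambda>y. y - x) ` B))"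
    by (rule moments(2))
qed

lemma sampled_with_spectrum_char:
  assumes "sampled_with_spectrum M t P s X \<Phi>"
  shows "char \<Phi> u = complex_of_real (covariance_function P X u)"
  using assms by (simp add: sampled_with_spectrum_def is_spectrum_def)

text \<open>
  Only an inequality is stated: the hypotheses are symmetric in the two processes, so equality
  follows by exchanging them, and the proof needs to treat one sign of the difference only.
\<close>

lemma covariance_le_beyond_if_same_covariance_measure:
  assumes tm: "sampling_times M t" and d: "d > 0" and sep: "separated_points M t d"
    and dens: "distributed M lborel (spacing t 0) f" and pos: "\<And>u. u \<ge> a \<Longrightarrow> f u > 0"
    and X: "sampled_with_spectrum M t P s X \<Phi>" and Y: "sampled_with_spectrum M t Q r Y \<Psi>"
    and \<Phi>: "\<Phi> \<in> band_limited_spectra w" and \<Psi>: "\<Psi> \<in> band_limited_spectra w"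
    and \<mu>X: "is_reduced_covariance_measure P (compound_process s X) \<mu>"
    and \<mu>Y: "is_reduced_covariance_measure Q (compound_process r Y) \<mu>"
    and "u > a"
  shows "covariance_function P X u \<le> covariance_function Q Y u"
proof (rule ccontr)
  define D where "D v = covariance_function P X v - covariance_function Q Y v" for v
  assume "\<not> ?thesis"
  then have "D u > 0" by (simp add: D_def)
  have D_eq: "D v = Re (fourier_extension \<Phi> (of_real v) - fourier_extension \<Psi> (of_real v))" for v
    using sampled_with_spectrum_char[OF X] sampled_with_spectrum_char[OF Y]
    by (simp add: fourier_extension_of_real D_def)
  have "continuous_on UNIV D"
  proof -
    have "continuous_on UNIV (\<lambda>v. G (complex_of_real v))" if "G holomorphic_on UNIV" for G
      using holomorphic_on_imp_continuous_on[OF that]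
      by (rule continuous_on_compose2) (auto intro!: continuous_intros)
    then show ?thesis
      unfolding D_eq using \<Phi> \<Psi>
      by (intro continuous_on_Re continuous_on_diff) (auto intro: fourier_extension_entire)
  qed
  then have "isCont D u"
    by (simp add: continuous_on_eq_continuous_at)
  then have "eventually (\<lambda>v. D v > 0) (nhds u)"
    using \<open>D u > 0\<close> by (simp add: isCont_def tendsto_at_iff_tendsto_nhds order_tendstoD(1))
  then obtain e0 where e0: "e0 > 0" "\<And>v. \<bar>v - u\<bar> < e0 \<Longrightarrow> D v > 0"
    by (auto simp: eventually_nhds_metric dist_real_def)
  \<comment> \<open>Within \<open>2 * e\<close> of \<open>u\<close> the difference stays positive, and within \<open>e\<close> of \<open>u\<close> so does the
      density.\<close>
  define e where "e = min (e0 / 2) (u - a)"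
  have e: "e > 0" "2 * e \<le> e0" "e \<le> u - a"
    using e0(1) \<open>u > a\<close> by (auto simp: e_def min_def)
  have D_int: "integrable (law M t) (pair_sum D A B)"
    and D_null: "(LINT \<tau>|law M t. pair_sum D A B \<tau>) = 0"
    if "A \<in> bounded_borel" "B \<in> bounded_borel" for A B
  proof -
    have eq: "pair_sum D A B = (\<lambda>\<tau>. pair_sum (covariance_function P X) A B \<tau> -
        pair_sum (covariance_function Q Y) A B \<tau>)"
      unfolding pair_sum_diff D_def ..
    show "integrable (law M t) (pair_sum D A B)" "(LINT \<tau>|law M t. pair_sum D A B \<tau>) = 0"
      unfolding eq using covariance_measure_determines_pair_sums[OF X \<mu>X that]
        covariance_measure_determines_pair_sums[OF Y \<mu>Y that] by auto
  qed
  have "AE \<omega> in M. \<not> \<bar>spacing t 0 \<omega> - u\<bar> < e"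
    using e e0 by (intro AE_spacing_not_near_if_pair_sums_null[OF tm d sep _ _ D_int D_null]) auto
  moreover have "\<not> (AE \<omega> in M. \<not> \<bar>spacing t 0 \<omega> - u\<bar> < e)"
    using e by (intro not_AE_avoids_if_density_pos[OF dens]) (auto intro: pos simp: abs_less_iff)
  ultimately show False
    by simp
qed

theorem theorem5:
  fixes M :: "'w measure"
    and t :: "int \<Rightarrow> 'w \<Rightarrow> real"
    and d a w :: real
    and f :: "real \<Rightarrow> ennreal"
  assumes "d > 0"
    and "sampling_times M t"
    and "renewal_sampling M t"
    and "stationary_points M t" "orderly_points M t" "second_order_points M t"
    and "separated_points M t d"
    and "\<And>n. distributed M lborel (spacing t n) f"
    and "\<And>u. u \<ge> a \<Longrightarrow> f u > 0"
    and "w > 0"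
  shows "alias_free TYPE('p) M t (band_limited_spectra w)"
  unfolding alias_free_def
proof (intro notI, elim exE conjE)
  fix P Q :: "'p measure" and s r X Y \<Phi> \<Psi> \<mu>
  assume bl: "\<Phi> \<in> band_limited_spectra w" "\<Psi> \<in> band_limited_spectra w" and "\<Phi> \<noteq> \<Psi>"
    and X: "sampled_with_spectrum M t P s X \<Phi>" and Y: "sampled_with_spectrum M t Q r Y \<Psi>"
    and \<mu>: "is_reduced_covariance_measure P (compound_process s X) \<mu>"
      "is_reduced_covariance_measure Q (compound_process r Y) \<mu>"
  note le = covariance_le_beyond_if_same_covariance_measure
    [OF assms(2,1,7) assms(8)[of 0] assms(9)]
  have "covariance_function P X u = covariance_function Q Y u" if "u > a" for u
    using le[OF _ X Y bl \<mu> that] le[OF _ Y X bl(2,1) \<mu>(2,1) that] by (intro antisym)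
  then have "char \<Phi> u = char \<Psi> u" if "u > a" for u
    using that by (simp add: sampled_with_spectrum_char[OF X] sampled_with_spectrum_char[OF Y])
  then have "char \<Phi> = char \<Psi>"
    by (rule band_limited_char_eq_if_eq_on_half_line[OF bl])
  then have "\<Phi> = \<Psi>"
    using bl by (intro finite_borel_measure_char_unique) (auto simp: band_limited_spectra_def)
  then show False
    using \<open>\<Phi> \<noteq> \<Psi>\<close> by simp
qed

end
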